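(* Let $D$ be a defeasible theory and $q$ a ground literal of $D$ (written $p(\vec a)$ or $\neg p(\vec a)$ in $D$, and represented by $\mathtt{p}(\vec a)$ or $\mathtt{not\_p}(\vec a)$ in $\mathcal M_{\partial_{||}}(D)$). Then $q\in P_\Delta$ iff $\mathcal M_{\partial_{||}}(D)\models_{WF}\mathtt{definitely}(q)$, and $q\in P_\lambda$ iff $\mathcal M_{\partial_{||}}(D)\models_{WF}\mathtt{lambda}(q)$.
   Context: Defeasible theories. A literal is an atom $p(t_1,\dots,t_n)$ or its classical negation $\neg p(t_1,\dots,t_n)$; ${\sim}q$ is the complementary literal. A defeasible theory $D=(F,R,>)$ has a finite set $F$ of variable-free literals (facts), a finite set $R$ of labelled rules $r$ with antecedent set $A(r)$, consequent $C(r)$ and kind strict ($\to$), defeasible ($\Rightarrow$) or defeater ($\leadsto$), and an acyclic superiority relation $>$ on labels. $R_s$: strict rules; $R_{sd}$: strict or defeasible rules; $R[q]$: rules with consequent $q$. A non-ground theory is identified with the set of ground instances of its rules. $P_\Delta$ is the least set of ground literals with $q\in P_\Delta$ whenever $q\in F$ or some $r\in R_s[q]$ has $A(r)\subseteq P_\Delta$. $P_\lambda$ is the least set with $q\in P_\lambda$ whenever $q\in P_\Delta$, or some $r\in R_{sd}[q]$ has $A(r)\subseteq P_\lambda$ and ${\sim}q\notin P_\Delta$. Metaprogram. $D$ is represented by unit clauses $\mathtt{fact}(q)$ ($q\in F$), $\mathtt{strict}(r,q,[q_1,\dots,q_n])$, $\mathtt{defeasible}(r,q,[q_1,\dots,q_n])$,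 $\mathtt{defeater}(r,q,[q_1,\dots,q_n])$ (for rules $r:q_1,\dots,q_n\hookrightarrow q$ of the respective kind), $\mathtt{sup}(r,s)$ ($r>s$), with predicates of $D$ as function symbols and $\neg p(\vec t)$ written $\mathtt{not\_p}(\vec t)$; and for each predicate $p$, $\mathtt{neg}(\mathtt{p}(\vec X),\mathtt{not\_p}(\vec X))$ and $\mathtt{neg}(\mathtt{not\_p}(\vec X),\mathtt{p}(\vec X))$. $\mathcal M_{\partial_{||}}(D)$ is this together with: $\mathtt{rule}(R,H,B)\,\text{:-}\,\mathtt{strict\_or\_defeasible}(R,H,B)$; $\mathtt{rule}(R,H,B)\,\text{:-}\,\mathtt{defeater}(R,H,B)$; $\mathtt{strict\_or\_defeasible}(R,H,B)\,\text{:-}\,\mathtt{strict}(R,H,B)$; $\mathtt{strict\_or\_defeasible}(R,H,B)\,\text{:-}\,\mathtt{defeasible}(R,H,B)$; for $\tau\in\{\mathtt{definitely},\mathtt{lambda},\mathtt{defeasibly}\}$: $\mathtt{loop\_}\tau([\,])$, $\mathtt{loop\_}\tau([H|T])\,\text{:-}\,\tau(H),\mathtt{loop\_}\tau(T)$; $\mathtt{definitely}(X)\,\text{:-}\,\mathtt{fact}(X)$; $\mathtt{definitely}(X)\,\text{:-}\,\mathtt{strict}(R,X,Y),\mathtt{loop\_definitely}(Y)$; $\mathtt{lambda}(X)\,\text{:-}\,\mathtt{definitely}(X)$; $\mathtt{lambda}(X)\,\text{:-}\,\mathtt{neg}(X,X'),\ not\ \mathtt{definitely}(X'),\ \mathtt{strict\_or\_defeasible}(R,X,Y),\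 \mathtt{loop\_lambda}(Y)$; $\mathtt{defeasibly}(X)\,\text{:-}\,\mathtt{definitely}(X)$; $\mathtt{defeasibly}(X)\,\text{:-}\,\mathtt{neg}(X,X'),\ not\ \mathtt{definitely}(X'),\ \mathtt{strict\_or\_defeasible}(R,X,Y),\ \mathtt{loop\_defeasibly}(Y),\ not\ \mathtt{overruled}(X)$; $\mathtt{overruled}(X)\,\text{:-}\,\mathtt{neg}(X,X'),\ \mathtt{rule}(S,X',U),\ \mathtt{loop\_lambda}(U),\ not\ \mathtt{defeated}(S,X')$; $\mathtt{defeated}(S,X')\,\text{:-}\,\mathtt{neg}(X,X'),\ \mathtt{sup}(T,S),\ \mathtt{strict\_or\_defeasible}(T,X,V),\ \mathtt{loop\_defeasibly}(V)$. $P\models_{WF}\ell$ means the ground literal $\ell$ holds in the well-founded model of the logic program $P$. *)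

theory Defs
  imports Main
begin

section \<open>Terms\<close>

datatype ('f, vars: 'v) trm = Var 'v | Fn 'f "('f, 'v) trm list"

datatype 'f gterm = GFn 'f "'f gterm list"

primrec inst :: "('v \<Rightarrow> 'f gterm) \<Rightarrow> ('f, 'v) trm \<Rightarrow> 'f gterm" where
  "inst \<sigma> (Var x) = \<sigma> x"
| "inst \<sigma> (Fn f ts) = GFn f (map (inst \<sigma>) ts)"

primrec trm_of_gterm :: "'f gterm \<Rightarrow> ('f, 'v) trm" where
  "trm_of_gterm (GFn f ts) = Fn f (map trm_of_gterm ts)"

text \<open>A symbol is identified by its name together with its arity.\<close>

primrec trm_symbols :: "('f, 'v) trm \<Rightarrow> ('f \<times> nat) set" where
  "trm_symbols (Var x) = {}"
| "trm_symbols (Fn f ts) = insert (f, length ts) (\<Union>(set (map trm_symbols ts)))"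

inductive_set gterms :: "('f \<times> nat) set \<Rightarrow> 'f gterm set" for F where
  "(f, length ts) \<in> F \<Longrightarrow> \<forall>t \<in> set ts. t \<in> gterms F \<Longrightarrow> GFn f ts \<in> gterms F"


section \<open>Normal logic programs and the well-founded semantics\<close>

datatype ('p, 't) atom = Atom (pred: 'p) (args: "'t list")

datatype ('p, 't) plit = Holds "('p, 't) atom" | Naf "('p, 't) atom"

datatype ('p, 't) clause =
  Clause (head: "('p, 't) atom") (body: "('p, 't) plit list")  (infix ":-" 55)

type_synonym ('p, 'f, 'v) program = "('p, ('f, 'v) trm) clause set"

fun plit_atom :: "('p, 't) plit \<Rightarrow> ('p, 't) atom" where
  "plit_atom (Holds A) = A"
| "plit_atom (Naf A) = A"

fun plit_compl :: "('p, 't) plit \<Rightarrow> ('p, 't) plit" where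
  "plit_compl (Holds A) = Naf A"
| "plit_compl (Naf A) = Holds A"

definition clause_atoms :: "('p, 't) clause \<Rightarrow> ('p, 't) atom set" where
  "clause_atoms c = insert (head c) (plit_atom ` set (body c))"

definition clause_terms :: "('p, 't) clause \<Rightarrow> 't set" where
  "clause_terms c = (\<Union>A \<in> clause_atoms c. set (args A))"

definition program_symbols :: "('p, 'f, 'v) program \<Rightarrow> ('f \<times> nat) set" where
  "program_symbols P = (\<Union>c \<in> P. \<Union>t \<in> clause_terms c. trm_symbols t)"

definition program_preds :: "('p, 'f, 'v) program \<Rightarrow> ('p \<times> nat) set" where
  "program_preds P = (\<Union>c \<in> P. (\<lambda>A. (pred A, length (args A))) ` clause_atoms c)"

text \<open>No fresh constant is added when \<open>P\<close> has none; the metaprogram below always contains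
  the constant for the empty list.\<close>

definition herbrand_universe :: "('p, 'f, 'v) program \<Rightarrow> 'f gterm set" where
  "herbrand_universe P = gterms (program_symbols P)"

definition herbrand_base :: "('p, 'f, 'v) program \<Rightarrow> ('p, 'f gterm) atom set" where
  "herbrand_base P =
     {A. (pred A, length (args A)) \<in> program_preds P \<and> set (args A) \<subseteq> herbrand_universe P}"

definition ground_program :: "('p, 'f, 'v) program \<Rightarrow> ('p, 'f gterm) clause set" where
  "ground_program P =
     {map_clause id (inst \<sigma>) c | c \<sigma>.
        c \<in> P \<and> (\<forall>t \<in> clause_terms c. \<forall>x \<in> vars t. \<sigma> x \<in> herbrand_universe P)}"

text \<open>The well-founded model after Van Gelder, Ross and Schlipf. A partial interpretation is the
  set of ground literals that it makes true.\<close>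

definition unfounded ::
  "('p, 'f, 'v) program \<Rightarrow> ('p, 'f gterm) plit set \<Rightarrow> ('p, 'f gterm) atom set \<Rightarrow> bool" where
  "unfounded P I U \<longleftrightarrow>
     U \<subseteq> herbrand_base P \<and>
     (\<forall>c \<in> ground_program P. head c \<in> U \<longrightarrow>
        (\<exists>l \<in> set (body c). plit_compl l \<in> I) \<or> (\<exists>A \<in> U. Holds A \<in> set (body c)))"

definition greatest_unfounded ::
  "('p, 'f, 'v) program \<Rightarrow> ('p, 'f gterm) plit set \<Rightarrow> ('p, 'f gterm) atom set" where
  "greatest_unfounded P I = \<Union>{U. unfounded P I U}"

definition T_op ::
  "('p, 'f, 'v) program \<Rightarrow> ('p, 'f gterm) plit set \<Rightarrow> ('p, 'f gterm) atom set" where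
  "T_op P I = {head c | c. c \<in> ground_program P \<and> set (body c) \<subseteq> I}"

definition W_op ::
  "('p, 'f, 'v) program \<Rightarrow> ('p, 'f gterm) plit set \<Rightarrow> ('p, 'f gterm) plit set" where
  "W_op P I = Holds ` T_op P I \<union> Naf ` greatest_unfounded P I"

lemma mono_W_op: "mono (W_op P)"
proof (rule monoI)
  fix I J :: "('a, 'b gterm) plit set"
  assume "I \<subseteq> J"
  then have "T_op P I \<subseteq> T_op P J" and "\<And>U. unfounded P I U \<Longrightarrow> unfounded P J U"
    unfolding T_op_def unfounded_def by blast+
  then show "W_op P I \<subseteq> W_op P J"
    unfolding W_op_def greatest_unfounded_def by blast
qed

definition wf_model :: "('p, 'f, 'v) program \<Rightarrow> ('p, 'f gterm) plit set" where
  "wf_model P = lfp (W_op P)"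

definition wf_entails :: "('p, 'f, 'v) program \<Rightarrow> ('p, 'f gterm) plit \<Rightarrow> bool"
    (infix "\<Turnstile>\<^sub>W\<^sub>F" 50) where
  "P \<Turnstile>\<^sub>W\<^sub>F l \<longleftrightarrow> l \<in> wf_model P"


section \<open>Defeasible theories\<close>

text \<open>\<open>Neg\<close> is classical negation, unlike \<open>Naf\<close> above.\<close>

datatype ('p, 't) dlit = Pos 'p "'t list" | Neg 'p "'t list"

fun compl :: "('p, 't) dlit \<Rightarrow> ('p, 't) dlit" where
  "compl (Pos p ts) = Neg p ts"
| "compl (Neg p ts) = Pos p ts"

fun dlit_pred :: "('p, 't) dlit \<Rightarrow> 'p \<times> nat" where
  "dlit_pred (Pos p ts) = (p, length ts)"
| "dlit_pred (Neg p ts) = (p, length ts)"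

fun dlit_args :: "('p, 't) dlit \<Rightarrow> 't list" where
  "dlit_args (Pos p ts) = ts"
| "dlit_args (Neg p ts) = ts"

datatype kind = Strict | Defeasible | Defeater

text \<open>The antecedent is kept as a list because the metaprogram lists it; the antecedent set of
  \<open>r\<close> is \<open>set (antecedent r)\<close>.\<close>

datatype ('l, 'a) drule =
  DRule (label: 'l) (kind: kind) (antecedent: "'a list") (consequent: 'a)

text \<open>\<open>(r, s) \<in> superiority D\<close> means \<open>r > s\<close>.\<close>

record ('l, 'p, 'f, 'v) dtheory =
  facts :: "('p, 'f gterm) dlit set"
  rules :: "('l, ('p, ('f, 'v) trm) dlit) drule set"
  superiority :: "('l \<times> 'l) set"

text \<open>The language in which a theory is written. It may have more symbols than occur in the
  theory, for instance a constant added so that variables have instances.\<close>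

record ('f, 'p) language =
  fun_symbols :: "('f \<times> nat) set"
  pred_symbols :: "('p \<times> nat) set"

definition ground_literals :: "('f, 'p) language \<Rightarrow> ('p, 'f gterm) dlit set" where
  "ground_literals L =
     {q. dlit_pred q \<in> pred_symbols L \<and> set (dlit_args q) \<subseteq> gterms (fun_symbols L)}"

definition literals :: "('f, 'p) language \<Rightarrow> ('p, ('f, 'v) trm) dlit set" where
  "literals L =
     {q. dlit_pred q \<in> pred_symbols L \<and> (\<forall>t \<in> set (dlit_args q). trm_symbols t \<subseteq> fun_symbols L)}"

definition drule_literals :: "('l, 'a) drule \<Rightarrow> 'a set" where
  "drule_literals r = insert (consequent r) (set (antecedent r))"

definition defeasible_theory :: "('f, 'p) language \<Rightarrow> ('l, 'p, 'f, 'v) dtheory \<Rightarrow> bool" where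
  "defeasible_theory L D \<longleftrightarrow>
     finite (facts D) \<and> facts D \<subseteq> ground_literals L \<and>
     finite (rules D) \<and> (\<forall>r \<in> rules D. drule_literals r \<subseteq> literals L) \<and>
     acyclic (superiority D)"

text \<open>All ground instances of a rule carry the label of that rule.\<close>

definition ground_rules ::
  "('f, 'p) language \<Rightarrow> ('l, 'p, 'f, 'v) dtheory \<Rightarrow> ('l, ('p, 'f gterm) dlit) drule set" where
  "ground_rules L D =
     {map_drule id (map_dlit id (inst \<sigma>)) r | r \<sigma>.
        r \<in> rules D \<and>
        (\<forall>q \<in> drule_literals r. \<forall>t \<in> set (dlit_args q). \<forall>x \<in> vars t. \<sigma> x \<in> gterms (fun_symbols L))}"

inductive_set P_Delta :: "('f, 'p) language \<Rightarrow> ('l, 'p, 'f, 'v) dtheory \<Rightarrow> ('p, 'f gterm) dlit set"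
  for L D where
  "q \<in> facts D \<Longrightarrow> q \<in> P_Delta L D"
| "r \<in> ground_rules L D \<Longrightarrow> kind r = Strict \<Longrightarrow> consequent r = q \<Longrightarrow>
   \<forall>a \<in> set (antecedent r). a \<in> P_Delta L D \<Longrightarrow> q \<in> P_Delta L D"

inductive_set P_lambda :: "('f, 'p) language \<Rightarrow> ('l, 'p, 'f, 'v) dtheory \<Rightarrow> ('p, 'f gterm) dlit set"
  for L D where
  "q \<in> P_Delta L D \<Longrightarrow> q \<in> P_lambda L D"
| "r \<in> ground_rules L D \<Longrightarrow> kind r \<in> {Strict, Defeasible} \<Longrightarrow> consequent r = q \<Longrightarrow>
   \<forall>a \<in> set (antecedent r). a \<in> P_lambda L D \<Longrightarrow> compl q \<notin> P_Delta L D \<Longrightarrow> q \<in> P_lambda L D"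


section \<open>The metaprogram\<close>

datatype mpred =
    fact | strict | defeasible | defeater | sup | neg
  | rule | strict_or_defeasible
  | definitely | loop_definitely
  | lambda | loop_lambda
  | defeasibly | loop_defeasibly
  | overruled | defeated

text \<open>\<open>PosF p\<close> and \<open>NegF p\<close> are the function symbols \<open>p\<close> and \<open>not_p\<close>.\<close>

datatype ('f, 'p, 'l) mfun = ObjF 'f | PosF 'p | NegF 'p | LabelF 'l | NilF | ConsF

datatype mvar = Named string | Arg nat

fun enc_lit :: "('p, 'f gterm) dlit \<Rightarrow> ('f, 'p, 'l) mfun gterm" where
  "enc_lit (Pos p ts) = GFn (PosF p) (map (map_gterm ObjF) ts)"
| "enc_lit (Neg p ts) = GFn (NegF p) (map (map_gterm ObjF) ts)"

primrec enc_list :: "('f, 'p, 'l) mfun gterm list \<Rightarrow> ('f, 'p, 'l) mfun gterm" where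
  "enc_list [] = GFn NilF []"
| "enc_list (t # ts) = GFn ConsF [t, enc_list ts]"

definition enc_label :: "'l \<Rightarrow> ('f, 'p, 'l) mfun gterm" where
  "enc_label r = GFn (LabelF r) []"

type_synonym ('f, 'p, 'l) metaprogram = "(mpred, ('f, 'p, 'l) mfun, mvar) program"

definition unit_clause ::
  "mpred \<Rightarrow> ('f, 'p, 'l) mfun gterm list \<Rightarrow> (mpred, (('f, 'p, 'l) mfun, mvar) trm) clause" where
  "unit_clause p ts = Atom p (map trm_of_gterm ts) :- []"

fun kind_pred :: "kind \<Rightarrow> mpred" where
  "kind_pred Strict = strict"
| "kind_pred Defeasible = defeasible"
| "kind_pred Defeater = defeater"

text \<open>A theory with variables is identified with the set of its ground instances, so the unit
  clauses for rules are those of the ground instances. Non-ground unit clauses would be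
  instantiated over the larger Herbrand universe of the metaprogram, in which variables of the
  theory could also take literals, lists and labels as values.\<close>

definition theory_clauses ::
  "('f, 'p) language \<Rightarrow> ('l, 'p, 'f, 'v) dtheory \<Rightarrow> ('f, 'p, 'l) metaprogram" where
  "theory_clauses L D =
     {unit_clause fact [enc_lit q] | q. q \<in> facts D} \<union>
     {unit_clause (kind_pred (kind r))
        [enc_label (label r), enc_lit (consequent r), enc_list (map enc_lit (antecedent r))]
      | r. r \<in> ground_rules L D} \<union>
     {unit_clause sup [enc_label r, enc_label s] | r s. (r, s) \<in> superiority D}"

definition neg_clauses :: "('f, 'p) language \<Rightarrow> ('f, 'p, 'l) metaprogram" where
  "neg_clauses L =
     (\<Union>(p, n) \<in> pred_symbols L.
        let Xs = map (\<lambda>i. Var (Arg i)) [0..<n] in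
        {Atom neg [Fn (PosF p) Xs, Fn (NegF p) Xs] :- [],
         Atom neg [Fn (NegF p) Xs, Fn (PosF p) Xs] :- []})"

definition loop_clauses :: "mpred \<Rightarrow> mpred \<Rightarrow> ('f, 'p, 'l) metaprogram" where
  "loop_clauses loop \<tau> =
     (let H = Var (Named ''H''); T = Var (Named ''T'') in
      {Atom loop [Fn NilF []] :- [],
       Atom loop [Fn ConsF [H, T]] :- [Holds (Atom \<tau> [H]), Holds (Atom loop [T])]})"

definition inference_clauses :: "('f, 'p, 'l) metaprogram" where
  "inference_clauses =
     (let R = Var (Named ''R''); H = Var (Named ''H''); B = Var (Named ''B'');
          S = Var (Named ''S''); T = Var (Named ''T''); U = Var (Named ''U'');
          V = Var (Named ''V''); Y = Var (Named ''Y'');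
          X = Var (Named ''X''); X' = Var (Named ''X_prime'')
      in
      {Atom rule [R, H, B] :- [Holds (Atom strict_or_defeasible [R, H, B])],
       Atom rule [R, H, B] :- [Holds (Atom defeater [R, H, B])],
       Atom strict_or_defeasible [R, H, B] :- [Holds (Atom strict [R, H, B])],
       Atom strict_or_defeasible [R, H, B] :- [Holds (Atom defeasible [R, H, B])],
       Atom definitely [X] :- [Holds (Atom fact [X])],
       Atom definitely [X] :-
         [Holds (Atom strict [R, X, Y]), Holds (Atom loop_definitely [Y])],
       Atom lambda [X] :- [Holds (Atom definitely [X])],
       Atom lambda [X] :-
         [Holds (Atom neg [X, X']), Naf (Atom definitely [X']),
          Holds (Atom strict_or_defeasible [R, X, Y]), Holds (Atom loop_lambda [Y])],
       Atom defeasibly [X] :- [Holds (Atom definitely [X])],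
       Atom defeasibly [X] :-
         [Holds (Atom neg [X, X']), Naf (Atom definitely [X']),
          Holds (Atom strict_or_defeasible [R, X, Y]), Holds (Atom loop_defeasibly [Y]),
          Naf (Atom overruled [X])],
       Atom overruled [X] :-
         [Holds (Atom neg [X, X']), Holds (Atom rule [S, X', U]),
          Holds (Atom loop_lambda [U]), Naf (Atom defeated [S, X'])],
       Atom defeated [S, X'] :-
         [Holds (Atom neg [X, X']), Holds (Atom sup [T, S]),
          Holds (Atom strict_or_defeasible [T, X, V]), Holds (Atom loop_defeasibly [V])]})"

definition metaprogram ::
  "('f, 'p) language \<Rightarrow> ('l, 'p, 'f, 'v) dtheory \<Rightarrow> ('f, 'p, 'l) metaprogram" where
  "metaprogram L D =
     theory_clauses L D \<union> neg_clauses L \<union>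
     loop_clauses loop_definitely definitely \<union>
     loop_clauses loop_lambda lambda \<union>
     loop_clauses loop_defeasibly defeasibly \<union>
     inference_clauses"

end

theory Submission
  imports Defs
begin

text \<open>\<open>definitely\<close> is defined by a negation-free part of the metaprogram, and \<open>lambda\<close> negates only
  \<open>definitely\<close>. The well-founded model of these two strata is therefore total and is given by
  iterated least models, regardless of the other predicates, which may depend on each other
  through negation: an inconsistent interpretation that makes all their literals true is still a
  pre-fixpoint of the well-founded operator. The iterated least models are then compared with
  \<open>P_Delta\<close> and \<open>P_lambda\<close> by rule induction in both directions. Only encodings of literals are
  ever derived, although the clauses are instantiated over the whole Herbrand universe.\<close>


section \<open>Ground programs\<close>

lemma inst_trm_of_gterm [simp]: "inst \<sigma> (trm_of_gterm t) = t"
  by (induction t) (simp add: map_idI)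

lemma inst_in_gterms:
  assumes "trm_symbols t \<subseteq> F" and "\<forall>x \<in> vars t. \<sigma> x \<in> gterms F"
  shows "inst \<sigma> t \<in> gterms F"
  using assms
proof (induction t)
  case (Var x)
  then show ?case by simp
next
  case (Fn f ts)
  have "\<forall>t \<in> set (map (inst \<sigma>) ts). t \<in> gterms F"
    using Fn by fastforce
  then show ?case
    using Fn.prems by (auto intro!: gterms.intros)
qed

lemma gterms_args: "GFn f ts \<in> gterms F \<Longrightarrow> set ts \<subseteq> gterms F"
  by (erule gterms.cases) auto

text \<open>Asking for a total universe-valued \<open>\<sigma>\<close> avoids reasoning about which
  variables occur in \<open>c\<close>; a default value fills in the rest.\<close>

lemma ground_programI:
  assumes "c \<in> P" and "\<And>x. \<sigma> x \<in> herbrand_universe P"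
  shows "map_clause id (inst \<sigma>) c \<in> ground_program P"
  using assms unfolding ground_program_def by blast

lemma clause_atoms_map:
  "clause_atoms (map_clause f g c) = map_atom f g ` clause_atoms c"
proof -
  have "plit_atom (map_plit f g l) = map_atom f g (plit_atom l)" for l
    by (cases l) auto
  then show ?thesis
    by (cases c) (auto simp: clause_atoms_def image_image)
qed

text \<open>Predicates are inherited from the uninstantiated clause, and its terms are built from
  program symbols, so universe-valued substitutions keep them in the universe. Needed because
  unfounded sets must lie in the Herbrand base.\<close>

lemma ground_clause_atoms:
  assumes "c \<in> ground_program P"
  shows "clause_atoms c \<subseteq> herbrand_base P"
proof
  fix A
  assume "A \<in> clause_atoms c"
  with assms obtain c' \<sigma> A' where c': "c' \<in> P"
    and \<sigma>: "\<forall>t \<in> clause_terms c'. \<forall>x \<in> vars t. \<sigma> x \<in> herbrand_universe P"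
    and A': "A' \<in> clause_atoms c'" and A: "A = map_atom id (inst \<sigma>) A'"
    unfolding ground_program_def by (auto simp: clause_atoms_map)
  have "inst \<sigma> t \<in> herbrand_universe P" if "t \<in> set (args A')" for t
  proof -
    have t: "t \<in> clause_terms c'"
      using A' that by (auto simp: clause_terms_def)
    then have "trm_symbols t \<subseteq> program_symbols P"
      using c' by (auto simp: program_symbols_def)
    with t \<sigma> show ?thesis
      unfolding herbrand_universe_def by (blast intro: inst_in_gterms)
  qed
  moreover have "(pred A', length (args A')) \<in> program_preds P"
    using c' A' by (force simp: program_preds_def)
  ultimately show "A \<in> herbrand_base P"
    by (cases A') (auto simp: herbrand_base_def A)
qed

lemma Holds_in_herbrand_base:
  "c \<in> ground_program P \<Longrightarrow> Holds A \<in> set (body c) \<Longrightarrow> A \<in> herbrand_base P"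
  using ground_clause_atoms by (force simp: clause_atoms_def)

lemma Naf_in_herbrand_base:
  "c \<in> ground_program P \<Longrightarrow> Naf A \<in> set (body c) \<Longrightarrow> A \<in> herbrand_base P"
  using ground_clause_atoms by (force simp: clause_atoms_def)


section \<open>The well-founded model on the two lowest strata\<close>

text \<open>The least model of the Gelfond-Lifschitz reduct with respect to \<open>N\<close>,
  restricted to clauses whose head predicate is in \<open>Q\<close>. Keeping \<open>N\<close> a
  parameter lets one definition serve both strata.\<close>

inductive_set stratum_model ::
  "('p, 'f, 'v) program \<Rightarrow> 'p set \<Rightarrow> ('p, 'f gterm) atom set \<Rightarrow> ('p, 'f gterm) atom set"
  for P Q N where
  "c \<in> ground_program P \<Longrightarrow> pred (head c) \<in> Q \<Longrightarrow>
   \<forall>A. Holds A \<in> set (body c) \<longrightarrow> A \<in> stratum_model P Q N \<Longrightarrow>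
   \<forall>A. Naf A \<in> set (body c) \<longrightarrow> A \<notin> N \<Longrightarrow> head c \<in> stratum_model P Q N"

lemma stratum_model_args:
  assumes "A \<in> stratum_model P Q N"
  shows "set (args A) \<subseteq> herbrand_universe P"
  using assms
proof cases
  case (1 c)
  then show ?thesis
    using ground_clause_atoms[of c P] by (auto simp: clause_atoms_def herbrand_base_def)
qed

text \<open>Every negation is false in the first stratum since \<open>UNIV\<close> is taken as the model below it;
  nothing is lost because its clauses contain no negation.\<close>

locale two_strata =
  fixes P :: "('p, 'f, 'v) program" and Q1 Q2 :: "'p set"
  assumes first: "\<And>c l. c \<in> ground_program P \<Longrightarrow> pred (head c) \<in> Q1 \<Longrightarrow> l \<in> set (body c) \<Longrightarrow>
      \<exists>A. l = Holds A \<and> pred A \<in> Q1"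
    and second_Holds: "\<And>c A. c \<in> ground_program P \<Longrightarrow> pred (head c) \<in> Q2 \<Longrightarrow>
      Holds A \<in> set (body c) \<Longrightarrow> pred A \<in> Q2"
    and second_Naf: "\<And>c A. c \<in> ground_program P \<Longrightarrow> pred (head c) \<in> Q2 \<Longrightarrow>
      Naf A \<in> set (body c) \<Longrightarrow> pred A \<in> Q1"
    and Q1_subset: "Q1 \<subseteq> Q2"
begin

abbreviation "M1 \<equiv> stratum_model P Q1 UNIV"
abbreviation "M2 \<equiv> stratum_model P Q2 M1"

text \<open>With \<open>UNIV\<close> as the model below, a clause applied in \<open>M1\<close> has
  no negative literal, so it applies over any other \<open>N\<close> as well.\<close>

lemma M1_subset_M2: "M1 \<subseteq> M2"
proof
  fix A
  assume "A \<in> M1"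
  then show "A \<in> M2"
  proof induction
    case (1 c)
    then show ?case
      using Q1_subset by (auto intro!: stratum_model.intros)
  qed
qed

lemma pred_M1: "A \<in> M1 \<Longrightarrow> pred A \<in> Q1"
  by (erule stratum_model.cases) auto

lemma first_body_in_M1:
  assumes "c \<in> ground_program P" and "pred (head c) \<in> Q1"
    and "\<And>A. Holds A \<in> set (body c) \<Longrightarrow> A \<in> M1"
  shows "head c \<in> M1"
  using assms first[OF assms(1,2)] by (blast intro: stratum_model.intros)

lemma wf_model_unfold: "W_op P (wf_model P) = wf_model P"
  unfolding wf_model_def using mono_W_op by (rule lfp_unfold[symmetric])

text \<open>The first-stratum atoms missing from \<open>M1\<close> form an unfounded set: a clause
  for such an atom has a body atom also missing from \<open>M1\<close>, since otherwise its head
  would be derived.\<close>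

lemma Naf_in_wf_model:
  assumes "A \<in> herbrand_base P" and "pred A \<in> Q1" and "A \<notin> M1"
  shows "Naf A \<in> wf_model P"
proof -
  let ?U = "{A \<in> herbrand_base P. pred A \<in> Q1 \<and> A \<notin> M1}"
  have "\<exists>A \<in> ?U. Holds A \<in> set (body c)"
    if c: "c \<in> ground_program P" and head: "head c \<in> ?U" for c
  proof -
    obtain A where A: "Holds A \<in> set (body c)" "A \<notin> M1"
      using first_body_in_M1[OF c] head by blast
    moreover have "pred A \<in> Q1"
      using first[OF c _ A(1)] head by auto
    ultimately show ?thesis
      using Holds_in_herbrand_base[OF c] by blast
  qed
  then have "unfounded P (wf_model P) ?U"
    unfolding unfounded_def by blast
  then have "Naf A \<in> W_op P (wf_model P)"
    using assms by (auto simp: W_op_def greatest_unfounded_def)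
  then show ?thesis by (simp add: wf_model_unfold)
qed

text \<open>Rule induction: positive body literals are true by hypothesis, and negative ones concern
  first-stratum atoms outside \<open>M1\<close>, which are already known to be false.\<close>

lemma M2_in_wf_model:
  assumes "A \<in> M2"
  shows "Holds A \<in> wf_model P"
  using assms
proof induction
  case (1 c)
  have "l \<in> wf_model P" if "l \<in> set (body c)" for l
  proof (cases l)
    case (Holds A)
    then show ?thesis using 1 that by blast
  next
    case (Naf A)
    then show ?thesis
      using 1 that by (auto intro: Naf_in_wf_model Naf_in_herbrand_base second_Naf)
  qed
  then have "Holds (head c) \<in> W_op P (wf_model P)"
    using 1 by (auto simp: W_op_def T_op_def)
  then show ?case by (simp add: wf_model_unfold)
qed

text \<open>\<open>Naf A\<close> is unconstrained also for \<open>A\<close> in the second stratum only, because no clause of the two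
  strata negates such an atom.\<close>

definition upper_bound :: "('p, 'f gterm) plit set" where
  "upper_bound = Holds ` {A. pred A \<in> Q2 \<longrightarrow> A \<in> M2} \<union> Naf ` {A. pred A \<in> Q1 \<longrightarrow> A \<notin> M1}"

lemma Holds_in_upper_bound [simp]: "Holds A \<in> upper_bound \<longleftrightarrow> (pred A \<in> Q2 \<longrightarrow> A \<in> M2)"
  by (auto simp: upper_bound_def)

lemma Naf_in_upper_bound [simp]: "Naf A \<in> upper_bound \<longleftrightarrow> (pred A \<in> Q1 \<longrightarrow> A \<notin> M1)"
  by (auto simp: upper_bound_def)

text \<open>Induction along derivations in \<open>M1\<close>: the deriving clause has only positive
  literals, whose atoms are in \<open>M1\<close>, hence not falsified by \<open>upper_bound\<close>,
  and outside \<open>U\<close> by hypothesis. So neither excuse for unfoundedness is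
  available.\<close>

lemma unfounded_upper_bound:
  assumes "unfounded P upper_bound U" and "A \<in> M1"
  shows "A \<notin> U"
  using assms(2)
proof induction
  case (1 c)
  show ?case
  proof
    assume "head c \<in> U"
    then consider l where "l \<in> set (body c)" "plit_compl l \<in> upper_bound"
      | A where "A \<in> U" "Holds A \<in> set (body c)"
      using assms(1) 1 unfolding unfounded_def by blast
    then show False
    proof cases
      case 1
      then obtain A where "l = Holds A"
        using first[OF \<open>c \<in> ground_program P\<close> \<open>pred (head c) \<in> Q1\<close>] by blast
      with 1 show False
        using \<open>\<forall>A. Holds A \<in> set (body c) \<longrightarrow> A \<in> M1 \<and> A \<notin> U\<close> pred_M1
        by auto
    next
      case 2
      then show False
        using \<open>\<forall>A. Holds A \<in> set (body c) \<longrightarrow> A \<in> M1 \<and> A \<notin> U\<close> by blast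
    qed
  qed
qed

text \<open>A pre-fixpoint bounds the least fixpoint. Only heads in \<open>Q2\<close> need an
  argument for truth, and there the stratification makes the constraints of
  \<open>upper_bound\<close> apply to every body literal.\<close>

lemma wf_model_subset_upper_bound: "wf_model P \<subseteq> upper_bound"
  unfolding wf_model_def
proof (rule lfp_lowerbound)
  have "head c \<in> M2"
    if c: "c \<in> ground_program P" "pred (head c) \<in> Q2" and "set (body c) \<subseteq> upper_bound" for c
  proof (rule stratum_model.intros[OF c])
    show "\<forall>A. Holds A \<in> set (body c) \<longrightarrow> A \<in> M2"
      using second_Holds[OF c] that by fastforce
    show "\<forall>A. Naf A \<in> set (body c) \<longrightarrow> A \<notin> M1"
      using second_Naf[OF c] that by fastforce
  qed
  then have "T_op P upper_bound \<subseteq> {A. pred A \<in> Q2 \<longrightarrow> A \<in> M2}"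
    unfolding T_op_def by blast
  then have "Holds ` T_op P upper_bound \<subseteq> upper_bound"
    by auto
  moreover have "Naf ` greatest_unfounded P upper_bound \<subseteq> upper_bound"
    using unfounded_upper_bound by (auto simp: greatest_unfounded_def)
  ultimately show "W_op P upper_bound \<subseteq> upper_bound"
    by (simp add: W_op_def)
qed

lemma wf_entails_iff_M2:
  assumes "pred A \<in> Q2"
  shows "P \<Turnstile>\<^sub>W\<^sub>F Holds A \<longleftrightarrow> A \<in> M2"
  using M2_in_wf_model wf_model_subset_upper_bound assms
  unfolding wf_entails_def by (metis Holds_in_upper_bound subsetD)

end


section \<open>The encoding\<close>

lemma inj_map_ObjF: "map (map_gterm ObjF) ts = map (map_gterm ObjF) us \<longleftrightarrow> ts = us"
  by (intro inj_map_eq_map gterm.inj_map injI) simp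

lemma enc_lit_inject [simp]: "enc_lit q = enc_lit q' \<longleftrightarrow> q = q'"
  by (cases q; cases q') (simp_all add: inj_map_ObjF)

lemma enc_list_inject [simp]: "enc_list ts = enc_list us \<longleftrightarrow> ts = us"
proof (induction ts arbitrary: us)
  case Nil
  then show ?case by (cases us) simp_all
next
  case (Cons t ts)
  then show ?case by (cases us) simp_all
qed

lemma map_enc_lit_inject [simp]: "map enc_lit qs = map enc_lit qs' \<longleftrightarrow> qs = qs'"
  by (simp add: inj_map_eq_map inj_def)

text \<open>Has the same disjunctive shape as the reading of \<open>neg\<close> in
  \<open>meaning\<close>, so a \<open>neg\<close> atom can be turned into a complement
  directly.\<close>

lemma enc_lit_compl_iff:
  "enc_lit (compl q) = t \<longleftrightarrow>
     (\<exists>p us. enc_lit q = GFn (PosF p) us \<and> t = GFn (NegF p) us \<or>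
             enc_lit q = GFn (NegF p) us \<and> t = GFn (PosF p) us)"
  by (cases q) auto


section \<open>The metaprogram\<close>

text \<open>\<open>defeasible\<close>, \<open>neg\<close> and \<open>strict_or_defeasible\<close> do
  not feed \<open>definitely\<close>; they sit in this stratum because they are negation-free and
  the second clause for \<open>lambda\<close> depends on them.\<close>

definition definite_preds :: "mpred set" where
  "definite_preds =
     {fact, strict, defeasible, neg, strict_or_defeasible, definitely, loop_definitely}"

definition lambda_preds :: "mpred set" where
  "lambda_preds = definite_preds \<union> {lambda, loop_lambda}"

lemma ground_metaprogramE:
  assumes "c \<in> ground_program (metaprogram L D)"
  obtains \<sigma> c' where "c' \<in> metaprogram L D" and "c = map_clause id (inst \<sigma>) c'"
  using assms unfolding ground_program_def by blast

abbreviation rule_args ::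
  "('l, ('p, 'f gterm) dlit) drule \<Rightarrow> ('f, 'p, 'l) mfun gterm list" where
  "rule_args r \<equiv>
     [enc_label (label r), enc_lit (consequent r), enc_list (map enc_lit (antecedent r))]"

text \<open>An over-approximation of the ground clauses for \<open>lambda_preds\<close>: variables
  range over all ground terms, with no Herbrand universe condition. This suffices for stratification
  and soundness, and gives clean case analysis.\<close>

inductive lower_clause ::
  "('f, 'p) language \<Rightarrow> ('l, 'p, 'f, 'v) dtheory \<Rightarrow> (mpred, ('f, 'p, 'l) mfun gterm) clause \<Rightarrow> bool"
  for L D where
  fact: "q \<in> facts D \<Longrightarrow> lower_clause L D (Atom fact [enc_lit q] :- [])"
| strict: "r \<in> ground_rules L D \<Longrightarrow> kind r = Strict \<Longrightarrow>
    lower_clause L D (Atom strict (rule_args r) :- [])"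
| defeasible: "r \<in> ground_rules L D \<Longrightarrow> kind r = Defeasible \<Longrightarrow>
    lower_clause L D (Atom defeasible (rule_args r) :- [])"
| neg_Pos: "lower_clause L D (Atom neg [GFn (PosF p) ts, GFn (NegF p) ts] :- [])"
| neg_Neg: "lower_clause L D (Atom neg [GFn (NegF p) ts, GFn (PosF p) ts] :- [])"
| strict_or_defeasible: "k \<in> {strict, defeasible} \<Longrightarrow>
    lower_clause L D (Atom strict_or_defeasible [r, h, b] :- [Holds (Atom k [r, h, b])])"
| loop_Nil: "l \<in> {loop_definitely, loop_lambda} \<Longrightarrow>
    lower_clause L D (Atom l [GFn NilF []] :- [])"
| loop_Cons: "(l, \<tau>) \<in> {(loop_definitely, definitely), (loop_lambda, lambda)} \<Longrightarrow>
    lower_clause L D (Atom l [GFn ConsF [h, t]] :- [Holds (Atom \<tau> [h]), Holds (Atom l [t])])"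
| definitely_fact: "lower_clause L D (Atom definitely [x] :- [Holds (Atom fact [x])])"
| definitely_strict: "lower_clause L D
    (Atom definitely [x] :- [Holds (Atom strict [r, x, y]), Holds (Atom loop_definitely [y])])"
| lambda_definitely: "lower_clause L D (Atom lambda [x] :- [Holds (Atom definitely [x])])"
| lambda_rule: "lower_clause L D
    (Atom lambda [x] :-
      [Holds (Atom neg [x, x']), Naf (Atom definitely [x']),
       Holds (Atom strict_or_defeasible [r, x, y]), Holds (Atom loop_lambda [y])])"

text \<open>Case analysis on the origin of the clause; the head predicate rules out the clauses for
  defeaters, \<open>sup\<close> and everything from \<open>rule\<close> and
  \<open>defeasibly\<close> to \<open>defeated\<close>.\<close>

lemma lower_clauseI:
  assumes "c \<in> ground_program (metaprogram L D)" and "pred (head c) \<in> lambda_preds"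
  shows "lower_clause L D c"
proof -
  obtain c' \<sigma> where c': "c' \<in> metaprogram L D" and c: "c = map_clause id (inst \<sigma>) c'"
    using assms(1) by (rule ground_metaprogramE)
  have pred: "pred (head c') \<in> lambda_preds"
    using assms(2) unfolding c by (cases c'; cases "head c'") auto
  consider (rule) r where "r \<in> ground_rules L D"
      "c' = unit_clause (kind_pred (kind r)) (rule_args r)"
    | (fact) "c' \<in> {unit_clause fact [enc_lit q] | q. q \<in> facts D} \<union>
        {unit_clause sup [enc_label r, enc_label s] | r s. (r, s) \<in> superiority D}"
    | (neg) "c' \<in> neg_clauses L"
    | (loop) "c' \<in> loop_clauses loop_definitely definitely \<union> loop_clauses loop_lambda lambda \<union>
        loop_clauses loop_defeasibly defeasibly"
    | (inference) "c' \<in> inference_clauses"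
    using c' unfolding metaprogram_def theory_clauses_def by blast
  then show ?thesis
  proof cases
    case rule
    with pred show ?thesis
      by (cases "kind r")
        (auto simp: c unit_clause_def definite_preds_def lambda_preds_def
          intro: lower_clause.strict lower_clause.defeasible)
  next
    case fact
    with pred show ?thesis
      by (auto simp: c unit_clause_def definite_preds_def lambda_preds_def
          intro: lower_clause.fact)
  next
    case neg
    then show ?thesis
      by (auto simp: c neg_clauses_def Let_def intro: lower_clause.neg_Pos lower_clause.neg_Neg)
  next
    case loop
    with pred show ?thesis
      by (auto simp: c loop_clauses_def Let_def definite_preds_def lambda_preds_def
          intro: lower_clause.loop_Nil lower_clause.loop_Cons)
  next
    case inference
    with pred show ?thesis
      unfolding inference_clauses_def Let_def
      by (elim insertE emptyE)
        (simp_all add: c definite_preds_def lambda_preds_def lower_clause.intros)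
  qed
qed

text \<open>The only negation in a \<open>lower_clause\<close> is that of \<open>definitely\<close>
  in \<open>lambda_rule\<close>, whose head lies outside \<open>definite_preds\<close>.\<close>

interpretation meta: two_strata "metaprogram L D" definite_preds lambda_preds for L D
proof
  fix c l
  assume c: "c \<in> ground_program (metaprogram L D)" "pred (head c) \<in> definite_preds"
    and l: "l \<in> set (body c)"
  then have "lower_clause L D c"
    by (simp add: lower_clauseI lambda_preds_def)
  then show "\<exists>A. l = Holds A \<and> pred A \<in> definite_preds"
    using c(2) l by cases (auto simp: definite_preds_def)
next
  fix c A
  assume c: "c \<in> ground_program (metaprogram L D)" "pred (head c) \<in> lambda_preds"
    and A: "Holds A \<in> set (body c)"
  from c have "lower_clause L D c"
    by (rule lower_clauseI)
  then show "pred A \<in> lambda_preds"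
    using A by cases (auto simp: definite_preds_def lambda_preds_def)
next
  fix c A
  assume c: "c \<in> ground_program (metaprogram L D)" "pred (head c) \<in> lambda_preds"
    and A: "Naf A \<in> set (body c)"
  from c have "lower_clause L D c"
    by (rule lower_clauseI)
  then show "pred A \<in> definite_preds"
    using A by cases (auto simp: definite_preds_def)
qed (auto simp: lambda_preds_def)


section \<open>Soundness\<close>

text \<open>The induction invariant for soundness. It forces arguments to be encodings, except for
  \<open>neg\<close>, whose clauses also have instances with arbitrary terms
  \<open>us\<close>.\<close>

fun meaning ::
  "('f, 'p) language \<Rightarrow> ('l, 'p, 'f, 'v) dtheory \<Rightarrow> (mpred, ('f, 'p, 'l) mfun gterm) atom \<Rightarrow> bool"
  where
  "meaning L D (Atom fact ts) \<longleftrightarrow> (\<exists>q \<in> facts D. ts = [enc_lit q])"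
| "meaning L D (Atom strict ts) \<longleftrightarrow>
     (\<exists>r \<in> ground_rules L D. kind r = Strict \<and> ts = rule_args r)"
| "meaning L D (Atom defeasible ts) \<longleftrightarrow>
     (\<exists>r \<in> ground_rules L D. kind r = Defeasible \<and> ts = rule_args r)"
| "meaning L D (Atom strict_or_defeasible ts) \<longleftrightarrow>
     (\<exists>r \<in> ground_rules L D. kind r \<in> {Strict, Defeasible} \<and> ts = rule_args r)"
| "meaning L D (Atom neg ts) \<longleftrightarrow>
     (\<exists>p us. ts = [GFn (PosF p) us, GFn (NegF p) us] \<or> ts = [GFn (NegF p) us, GFn (PosF p) us])"
| "meaning L D (Atom definitely ts) \<longleftrightarrow> (\<exists>q \<in> P_Delta L D. ts = [enc_lit q])"
| "meaning L D (Atom loop_definitely ts) \<longleftrightarrow>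
     (\<exists>qs. set qs \<subseteq> P_Delta L D \<and> ts = [enc_list (map enc_lit qs)])"
| "meaning L D (Atom lambda ts) \<longleftrightarrow> (\<exists>q \<in> P_lambda L D. ts = [enc_lit q])"
| "meaning L D (Atom loop_lambda ts) \<longleftrightarrow>
     (\<exists>qs. set qs \<subseteq> P_lambda L D \<and> ts = [enc_list (map enc_lit qs)])"
| "meaning L D _ \<longleftrightarrow> True"

text \<open>Supplies the list witness for the \<open>loop_Cons\<close> case, where the encoded list
  appears unfolded.\<close>

lemma enc_list_Cons_exists:
  assumes "q \<in> X" and "set qs \<subseteq> X"
  shows "\<exists>rs. set rs \<subseteq> X \<and>
    GFn ConsF [enc_lit q, enc_list (map enc_lit qs)] = enc_list (map enc_lit rs)"
  using assms by (intro exI[of _ "q # qs"]) simp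

text \<open>Arbitrary \<open>Q\<close> and \<open>N\<close> let one induction cover both strata. The
  condition on \<open>N\<close> ensures that a successful negation of \<open>definitely\<close>
  really means absence from \<open>P_Delta\<close>.\<close>

lemma stratum_model_meaning:
  assumes "A \<in> stratum_model (metaprogram L D) Q N" and "Q \<subseteq> lambda_preds"
    and N: "\<And>q. q \<in> P_Delta L D \<Longrightarrow> Atom definitely [enc_lit q] \<in> N"
  shows "meaning L D A"
  using assms(1)
proof induction
  case (1 c)
  have IH: "\<And>A. Holds A \<in> set (body c) \<Longrightarrow> meaning L D A"
    and Naf: "\<And>A. Naf A \<in> set (body c) \<Longrightarrow> A \<notin> N"
    using 1 by blast+
  have "lower_clause L D c"
    using 1 assms(2) by (blast intro: lower_clauseI)
  then show ?case
  proof cases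
    case (strict_or_defeasible k r h b)
    then show ?thesis using IH[of "Atom k [r, h, b]"] by auto
  next
    case (loop_Nil l)
    have "\<exists>qs. set qs \<subseteq> X \<and> GFn NilF [] = enc_list (map enc_lit qs)" for X
      by (intro exI[of _ "[]"]) simp
    with loop_Nil show ?thesis by auto
  next
    case (loop_Cons l \<tau> h t)
    then show ?thesis
      using IH[of "Atom \<tau> [h]"] IH[of "Atom l [t]"] by (auto intro: enc_list_Cons_exists)
  next
    case (definitely_fact x)
    then show ?thesis
      using IH[of "Atom fact [x]"] by (auto intro: P_Delta.intros)
  next
    case (definitely_strict x r y)
    then obtain r' where r': "r' \<in> ground_rules L D" "kind r' = Strict"
      "x = enc_lit (consequent r')" "y = enc_list (map enc_lit (antecedent r'))"
      using IH[of "Atom strict [r, x, y]"] by auto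
    \<comment> \<open>Injectivity of the encoding identifies the list of the loop atom with the
      antecedent of \<open>r'\<close>.\<close>
    have "set (antecedent r') \<subseteq> P_Delta L D"
      using IH[of "Atom loop_definitely [y]"] definitely_strict r'(4) by auto
    then have "consequent r' \<in> P_Delta L D"
      using P_Delta.intros(2)[OF r'(1,2) refl] by blast
    then show ?thesis using definitely_strict r'(3) by auto
  next
    case (lambda_definitely x)
    then show ?thesis
      using IH[of "Atom definitely [x]"] by (auto intro: P_lambda.intros(1))
  next
    case (lambda_rule x x' r y)
    then obtain r' where r': "r' \<in> ground_rules L D" "kind r' \<in> {Strict, Defeasible}"
      "x = enc_lit (consequent r')" "y = enc_list (map enc_lit (antecedent r'))"
      using IH[of "Atom strict_or_defeasible [r, x, y]"] by auto
    \<comment> \<open>\<open>neg\<close> relates arbitrary terms, but its first argument is here an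
      encoded literal, which determines the second.\<close>
    have "enc_lit (compl (consequent r')) = x'"
      using IH[of "Atom neg [x, x']"] lambda_rule r'(3) by (auto simp: enc_lit_compl_iff)
    then have "compl (consequent r') \<notin> P_Delta L D"
      using Naf[of "Atom definitely [x']"] N lambda_rule by auto
    moreover have "set (antecedent r') \<subseteq> P_lambda L D"
      using IH[of "Atom loop_lambda [y]"] lambda_rule r'(4) by auto
    ultimately have "consequent r' \<in> P_lambda L D"
      using P_lambda.intros(2)[OF r'(1,2) refl] by blast
    then show ?thesis using lambda_rule r'(3) by auto
  qed auto
qed


section \<open>Completeness\<close>

text \<open>Lets a program clause be applied as written, with an explicit substitution.\<close>

lemma stratum_model_clauseI:
  assumes "h :- bs \<in> P" and "\<And>x. \<sigma> x \<in> herbrand_universe P" and "pred h \<in> Q"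
    and "\<And>A. Holds A \<in> set bs \<Longrightarrow> map_atom id (inst \<sigma>) A \<in> stratum_model P Q N"
    and "\<And>A. Naf A \<in> set bs \<Longrightarrow> map_atom id (inst \<sigma>) A \<notin> N"
  shows "map_atom id (inst \<sigma>) h \<in> stratum_model P Q N"
proof -
  have Holds: "\<exists>B. l = Holds B \<and> A = map_atom id (inst \<sigma>) B"
    if "Holds A = map_plit id (inst \<sigma>) l" for A l
    using that by (cases l) auto
  have Naf: "\<exists>B. l = Naf B \<and> A = map_atom id (inst \<sigma>) B"
    if "Naf A = map_plit id (inst \<sigma>) l" for A l
    using that by (cases l) auto
  have "head (map_clause id (inst \<sigma>) (h :- bs)) \<in> stratum_model P Q N"
  proof (rule stratum_model.intros)
    show "map_clause id (inst \<sigma>) (h :- bs) \<in> ground_program P"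
      using assms(1,2) by (rule ground_programI)
    show "pred (head (map_clause id (inst \<sigma>) (h :- bs))) \<in> Q"
      using assms(3) by (cases h) simp
  qed (use assms(4,5) Holds Naf in fastforce)+
  then show ?thesis by simp
qed

text \<open>The loop clauses contribute this constant for every theory, so it can serve as the
  default value of substitutions.\<close>

lemma Nil_in_universe: "GFn NilF [] \<in> herbrand_universe (metaprogram L D)"
proof -
  let ?c = "Atom loop_lambda [Fn NilF []] :- []"
  have "?c \<in> metaprogram L D"
    by (simp add: metaprogram_def loop_clauses_def Let_def)
  then have "(NilF, 0) \<in> program_symbols (metaprogram L D)"
    by (force simp: program_symbols_def clause_terms_def clause_atoms_def)
  then show ?thesis
    by (auto simp: herbrand_universe_def intro: gterms.intros)
qed

section \<open>Closure of the stratum models under the individual clauses\<close>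

context
  fixes L :: "('f, 'p) language" and D :: "('l, 'p, 'f, 'v) dtheory"
    and Q :: "mpred set" and N :: "(mpred, ('f, 'p, 'l) mfun gterm) atom set"
begin

abbreviation "HU \<equiv> herbrand_universe (metaprogram L D)"
abbreviation "M \<equiv> stratum_model (metaprogram L D) Q N"

lemma unit_in_model:
  assumes "unit_clause p ts \<in> metaprogram L D" and "p \<in> Q"
  shows "Atom p ts \<in> M"
  \<comment> \<open>A unit clause is ground, so a constant substitution will do.\<close>
  using stratum_model_clauseI[of "Atom p (map trm_of_gterm ts)" "[]" "metaprogram L D"
      "\<lambda>_. GFn NilF []"] assms
  by (simp add: unit_clause_def Nil_in_universe comp_def)

lemma fact_in_model: "q \<in> facts D \<Longrightarrow> fact \<in> Q \<Longrightarrow> Atom fact [enc_lit q] \<in> M"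
  by (rule unit_in_model) (auto simp: metaprogram_def theory_clauses_def)

lemma rule_in_model:
  "r \<in> ground_rules L D \<Longrightarrow> kind_pred (kind r) \<in> Q \<Longrightarrow> Atom (kind_pred (kind r)) (rule_args r) \<in> M"
  by (rule unit_in_model) (auto simp: metaprogram_def theory_clauses_def)

text \<open>Terms of an atom already derived lie in the Herbrand universe, so clause variables may
  be bound to them. The lemmas for the other inference clauses follow this pattern.\<close>

lemma strict_or_defeasible_in_model:
  assumes "Atom k [r, h, b] \<in> M" "k \<in> {strict, defeasible}" "strict_or_defeasible \<in> Q"
  shows "Atom strict_or_defeasible [r, h, b] \<in> M"
proof -
  let ?\<sigma> = "(\<lambda>_. GFn NilF [])(Named ''R'' := r, Named ''H'' := h, Named ''B'' := b)"
  let ?ts = "[Var (Named ''R''), Var (Named ''H''), Var (Named ''B'')]"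
  have "map_atom id (inst ?\<sigma>) (Atom strict_or_defeasible ?ts) \<in> M"
  proof (rule stratum_model_clauseI)
    show "Atom strict_or_defeasible ?ts :- [Holds (Atom k ?ts)] \<in> metaprogram L D"
      using assms(2) by (auto simp: metaprogram_def inference_clauses_def Let_def)
  qed (use assms stratum_model_args[OF assms(1)] in \<open>auto simp: Nil_in_universe\<close>)
  then show ?thesis by simp
qed

lemma loop_Nil_in_model:
  assumes "l \<in> {loop_definitely, loop_lambda}" "l \<in> Q"
  shows "Atom l [GFn NilF []] \<in> M"
proof -
  have "map_atom id (inst (\<lambda>_ :: mvar. GFn NilF [])) (Atom l [Fn NilF []]) \<in> M"
  proof (rule stratum_model_clauseI)
    show "Atom l [Fn NilF []] :- [] \<in> metaprogram L D"
      using assms(1) by (auto simp: metaprogram_def loop_clauses_def Let_def)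
  qed (use assms in \<open>auto simp: Nil_in_universe\<close>)
  then show ?thesis by simp
qed

lemma loop_Cons_in_model:
  assumes "(l, \<tau>) \<in> {(loop_definitely, definitely), (loop_lambda, lambda)}" "l \<in> Q"
    and "Atom \<tau> [h] \<in> M" "Atom l [t] \<in> M"
  shows "Atom l [GFn ConsF [h, t]] \<in> M"
proof -
  let ?\<sigma> = "(\<lambda>_. GFn NilF [])(Named ''H'' := h, Named ''T'' := t)"
  let ?H = "Var (Named ''H'')" and ?T = "Var (Named ''T'')"
  have "map_atom id (inst ?\<sigma>) (Atom l [Fn ConsF [?H, ?T]]) \<in> M"
  proof (rule stratum_model_clauseI)
    show "Atom l [Fn ConsF [?H, ?T]] :- [Holds (Atom \<tau> [?H]), Holds (Atom l [?T])]
        \<in> metaprogram L D"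
      using assms(1) by (auto simp: metaprogram_def loop_clauses_def Let_def)
  qed (use assms stratum_model_args[OF assms(3)] stratum_model_args[OF assms(4)]
      in \<open>auto simp: Nil_in_universe\<close>)
  then show ?thesis by simp
qed

lemma loop_in_model:
  assumes "(l, \<tau>) \<in> {(loop_definitely, definitely), (loop_lambda, lambda)}" "l \<in> Q"
    and "\<forall>q \<in> set qs. Atom \<tau> [enc_lit q] \<in> M"
  shows "Atom l [enc_list (map enc_lit qs)] \<in> M"
  using assms(3)
proof (induction qs)
  case Nil
  then show ?case using assms(1,2) loop_Nil_in_model by auto
next
  case (Cons q qs)
  then show ?case using loop_Cons_in_model[OF assms(1,2)] by simp
qed

lemma definitely_fact_in_model:
  assumes "Atom fact [x] \<in> M" "definitely \<in> Q"
  shows "Atom definitely [x] \<in> M"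
proof -
  let ?\<sigma> = "(\<lambda>_. GFn NilF [])(Named ''X'' := x)"
  let ?X = "Var (Named ''X'')"
  have "map_atom id (inst ?\<sigma>) (Atom definitely [?X]) \<in> M"
  proof (rule stratum_model_clauseI)
    show "Atom definitely [?X] :- [Holds (Atom fact [?X])] \<in> metaprogram L D"
      by (simp add: metaprogram_def inference_clauses_def Let_def)
  qed (use assms stratum_model_args[OF assms(1)] in \<open>auto simp: Nil_in_universe\<close>)
  then show ?thesis by simp
qed

lemma definitely_strict_in_model:
  assumes "Atom strict [r, x, y] \<in> M" "Atom loop_definitely [y] \<in> M" "definitely \<in> Q"
  shows "Atom definitely [x] \<in> M"
proof -
  let ?\<sigma> = "(\<lambda>_. GFn NilF [])(Named ''R'' := r, Named ''X'' := x, Named ''Y'' := y)"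
  let ?R = "Var (Named ''R'')" and ?X = "Var (Named ''X'')" and ?Y = "Var (Named ''Y'')"
  have "map_atom id (inst ?\<sigma>) (Atom definitely [?X]) \<in> M"
  proof (rule stratum_model_clauseI)
    show "Atom definitely [?X] :-
        [Holds (Atom strict [?R, ?X, ?Y]), Holds (Atom loop_definitely [?Y])] \<in> metaprogram L D"
      by (simp add: metaprogram_def inference_clauses_def Let_def)
  qed (use assms stratum_model_args[OF assms(1)] in \<open>auto simp: Nil_in_universe\<close>)
  then show ?thesis by simp
qed

lemma lambda_definitely_in_model:
  assumes "Atom definitely [x] \<in> M" "lambda \<in> Q"
  shows "Atom lambda [x] \<in> M"
proof -
  let ?\<sigma> = "(\<lambda>_. GFn NilF [])(Named ''X'' := x)"
  let ?X = "Var (Named ''X'')"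
  have "map_atom id (inst ?\<sigma>) (Atom lambda [?X]) \<in> M"
  proof (rule stratum_model_clauseI)
    show "Atom lambda [?X] :- [Holds (Atom definitely [?X])] \<in> metaprogram L D"
      by (simp add: metaprogram_def inference_clauses_def Let_def)
  qed (use assms stratum_model_args[OF assms(1)] in \<open>auto simp: Nil_in_universe\<close>)
  then show ?thesis by simp
qed

lemma lambda_rule_in_model:
  assumes "Atom neg [x, x'] \<in> M" "Atom definitely [x'] \<notin> N"
    and "Atom strict_or_defeasible [r, x, y] \<in> M" "Atom loop_lambda [y] \<in> M" "lambda \<in> Q"
  shows "Atom lambda [x] \<in> M"
proof -
  let ?\<sigma> = "(\<lambda>_. GFn NilF [])
    (Named ''R'' := r, Named ''X'' := x, Named ''Y'' := y, Named ''X_prime'' := x')"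
  let ?R = "Var (Named ''R'')" and ?X = "Var (Named ''X'')" and ?Y = "Var (Named ''Y'')"
    and ?X' = "Var (Named ''X_prime'')"
  have "map_atom id (inst ?\<sigma>) (Atom lambda [?X]) \<in> M"
  proof (rule stratum_model_clauseI)
    show "Atom lambda [?X] :-
        [Holds (Atom neg [?X, ?X']), Naf (Atom definitely [?X']),
         Holds (Atom strict_or_defeasible [?R, ?X, ?Y]), Holds (Atom loop_lambda [?Y])]
        \<in> metaprogram L D"
      by (simp add: metaprogram_def inference_clauses_def Let_def)
  qed (use assms stratum_model_args[OF assms(1)] stratum_model_args[OF assms(3)]
      in \<open>auto simp: Nil_in_universe\<close>)
  then show ?thesis by simp
qed

text \<open>The clause variables \<open>Arg i\<close> are bound to the arguments of
  \<open>q\<close>, which lie in the universe as subterms of \<open>enc_lit q\<close>. That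
  membership is assumed because \<open>L\<close> may have symbols absent from the
  metaprogram.\<close>

lemma neg_in_model:
  assumes "dlit_pred q \<in> pred_symbols L" "enc_lit q \<in> HU" "neg \<in> Q"
  shows "Atom neg [enc_lit q, enc_lit (compl q)] \<in> M"
proof -
  obtain p ts where q: "q = Pos p ts \<or> q = Neg p ts"
    by (cases q) auto
  let ?us = "map (map_gterm ObjF) ts"
  let ?Xs = "map (\<lambda>i. Var (Arg i)) [0..<length ts]"
  define \<sigma> :: "mvar \<Rightarrow> ('f, 'p, 'l) mfun gterm" where
    "\<sigma> x = (case x of Arg i \<Rightarrow> if i < length ts then ?us ! i else GFn NilF []
    | Named _ \<Rightarrow> GFn NilF [])" for x
  have "set ?us \<subseteq> HU"
    using q assms(2) unfolding herbrand_universe_def by (elim disjE) (auto dest!: gterms_args)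
  then have \<sigma>: "\<sigma> x \<in> HU" for x
    by (auto split: mvar.split simp: \<sigma>_def Nil_in_universe)
  have us: "map (inst \<sigma>) ?Xs = ?us"
    by (rule nth_equalityI) (simp_all add: \<sigma>_def)
  have pred: "(p, length ts) \<in> pred_symbols L"
    using q assms(1) by auto
  \<comment> \<open>Abstracting the two function symbols treats both orientations of
    \<open>neg\<close> at once.\<close>
  have "map_atom id (inst \<sigma>) (Atom neg [Fn f ?Xs, Fn g ?Xs]) \<in> M"
    if "f = PosF p \<and> g = NegF p \<or> f = NegF p \<and> g = PosF p" for f g
  proof (rule stratum_model_clauseI)
    show "Atom neg [Fn f ?Xs, Fn g ?Xs] :- [] \<in> metaprogram L D"
      using pred that by (force simp: metaprogram_def neg_clauses_def Let_def)
  qed (use assms(3) \<sigma> in auto)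
  from this[of "PosF p" "NegF p"] this[of "NegF p" "PosF p"] show ?thesis
    using q us by (auto simp del: map_map)
qed

section \<open>Rule inductions over \<open>P_Delta\<close> and \<open>P_lambda\<close>\<close>

lemma P_Delta_in_model:
  assumes "q \<in> P_Delta L D" and "definite_preds \<subseteq> Q"
  shows "Atom definitely [enc_lit q] \<in> M"
  using assms(1)
proof induction
  case (1 q)
  then show ?case
    using assms(2) by (auto simp: definite_preds_def intro: definitely_fact_in_model fact_in_model)
next
  case (2 r q)
  have "Atom strict (rule_args r) \<in> M"
    using rule_in_model[of r] 2 assms(2) by (simp add: definite_preds_def)
  moreover have "Atom loop_definitely [enc_list (map enc_lit (antecedent r))] \<in> M"
    using 2 assms(2) by (intro loop_in_model[where \<tau> = definitely]) (auto simp: definite_preds_def)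
  ultimately show ?case
    using 2 assms(2) definitely_strict_in_model by (auto simp: definite_preds_def)
qed

text \<open>The condition \<open>pred\<close> secures a \<open>neg\<close> clause for each rule
  head; the condition on \<open>N\<close> is the converse of the one used for soundness.\<close>

lemma P_lambda_in_model:
  assumes "q \<in> P_lambda L D" and Q: "lambda_preds \<subseteq> Q"
    and pred: "\<And>r. r \<in> ground_rules L D \<Longrightarrow> dlit_pred (consequent r) \<in> pred_symbols L"
    and N: "\<And>q. q \<notin> P_Delta L D \<Longrightarrow> Atom definitely [enc_lit q] \<notin> N"
  shows "Atom lambda [enc_lit q] \<in> M"
  using assms(1)
proof induction
  case (1 q)
  then have "Atom definitely [enc_lit q] \<in> M"
    using Q by (intro P_Delta_in_model) (auto simp: lambda_preds_def)
  then show ?case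
    using Q by (auto simp: lambda_preds_def intro: lambda_definitely_in_model)
next
  case (2 r q)
  have k: "kind_pred (kind r) \<in> {strict, defeasible}"
    using 2 by auto
  then have "Atom (kind_pred (kind r)) (rule_args r) \<in> M"
    using 2 Q by (intro rule_in_model) (auto simp: lambda_preds_def definite_preds_def)
  then have sd: "Atom strict_or_defeasible (rule_args r) \<in> M"
    using k Q by (intro strict_or_defeasible_in_model)
      (auto simp: lambda_preds_def definite_preds_def)
  \<comment> \<open>Read off from the derived rule atom, since membership in the language alone
    would not give it.\<close>
  then have "enc_lit q \<in> HU"
    using stratum_model_args 2 by fastforce
  then have "Atom neg [enc_lit q, enc_lit (compl q)] \<in> M"
    using 2 pred Q by (intro neg_in_model) (auto simp: lambda_preds_def definite_preds_def)
  moreover have "Atom loop_lambda [enc_list (map enc_lit (antecedent r))] \<in> M"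
    using 2 Q by (intro loop_in_model[where \<tau> = lambda]) (auto simp: lambda_preds_def)
  ultimately show ?case
    using sd 2 N Q by (intro lambda_rule_in_model) (auto simp: lambda_preds_def)
qed

end

lemma ground_rule_pred:
  assumes "defeasible_theory L D" and "r \<in> ground_rules L D"
  shows "dlit_pred (consequent r) \<in> pred_symbols L"
proof -
  from assms(2) obtain r' \<sigma> where "r' \<in> rules D"
    and r: "r = map_drule id (map_dlit id (inst \<sigma>)) r'"
    unfolding ground_rules_def by blast
  then have "consequent r' \<in> literals L"
    using assms(1) unfolding defeasible_theory_def drule_literals_def by blast
  then show ?thesis
    unfolding r by (cases r'; cases "consequent r'") (auto simp: literals_def)
qed

theorem theorem3:
  fixes L :: "('f, 'p) language"
    and D :: "('l, 'p, 'f, 'v) dtheory"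
    and q :: "('p, 'f gterm) dlit"
  assumes "defeasible_theory L D"
    and "q \<in> ground_literals L"
  shows "(q \<in> P_Delta L D \<longleftrightarrow>
            metaprogram L D \<Turnstile>\<^sub>W\<^sub>F Holds (Atom definitely [enc_lit q])) \<and>
         (q \<in> P_lambda L D \<longleftrightarrow>
            metaprogram L D \<Turnstile>\<^sub>W\<^sub>F Holds (Atom lambda [enc_lit q]))"
proof -
  let ?M1 = "stratum_model (metaprogram L D) definite_preds UNIV"
  let ?M2 = "stratum_model (metaprogram L D) lambda_preds ?M1"
  \<comment> \<open>Needed for every literal, as the second stratum tests complements. With
    \<open>UNIV\<close> below, the condition on \<open>N\<close> in the soundness lemma is
    trivial.\<close>
  have Delta: "Atom definitely [enc_lit q] \<in> ?M1 \<longleftrightarrow> q \<in> P_Delta L D" for q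
  proof
    assume "Atom definitely [enc_lit q] \<in> ?M1"
    then have "meaning L D (Atom definitely [enc_lit q])"
      by (rule stratum_model_meaning) (auto simp: lambda_preds_def)
    then show "q \<in> P_Delta L D" by simp
  qed (simp add: P_Delta_in_model)
  have meaning: "meaning L D A" if "A \<in> ?M2" for A
    using that by (rule stratum_model_meaning) (auto simp: Delta)
  \<comment> \<open>Entailment is characterised by the second model only, so
    \<open>definitely\<close> is transferred there from the first.\<close>
  have "Atom definitely [enc_lit q] \<in> ?M2 \<longleftrightarrow> q \<in> P_Delta L D"
    using meaning[of "Atom definitely [enc_lit q]"] Delta meta.M1_subset_M2 by auto
  moreover have "Atom lambda [enc_lit q] \<in> ?M2 \<longleftrightarrow> q \<in> P_lambda L D"
    using meaning[of "Atom lambda [enc_lit q]"]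
      P_lambda_in_model[OF _ subset_refl ground_rule_pred[OF assms(1)]] Delta by auto
  ultimately show ?thesis
    by (simp add: meta.wf_entails_iff_M2 lambda_preds_def definite_preds_def)
qed

end
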